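(* Each of the logics $\mathsf{SM}$, $\mathsf{LQM}$, $\mathsf{UQM}$, $\mathsf{DP}$, $\mathsf{AP}$, $\mathsf{WS}$ is complete with respect to the class of SMAs, LQMAs, UQMAs, DPLs, APLs, WSAs respectively. That is, for all formulas $A,B$ of $\mathcal{L}$: if $A\le B$ holds under every valuation in every algebra of the corresponding class, then the sequent $A\vdash B$ is derivable in the corresponding logic.
   Context: The language $\mathcal{L}$ over a denumerable set of propositional variables is $A ::= p \mid \top \mid \bot \mid \neg A \mid A\wedge A \mid A\vee A$. Semi De Morgan logic $\mathsf{SM}$ is the set of sequents $A\vdash B$ derivable from the axiom schemes $\bot\vdash A$, $A\vdash\top$, $\neg\top\vdash\bot$, $\top\vdash\neg\bot$, $A\vdash A$, $A\wedge B\vdash A$, $A\wedge B\vdash B$, $A\vdash A\vee B$, $B\vdash A\vee B$, $\neg A\vdash\neg\neg\neg A$, $\neg\neg\neg A\vdash\neg A$, $\neg A\wedge\neg B\vdash\neg(A\vee B)$, $\neg\neg A\wedge\neg\neg B\vdash\neg\neg(A\wedge B)$, $A\wedge(B\vee C)\vdash(A\wedge B)\vee(A\wedge C)$, using the rules: from $A\vdash B$ and $B\vdash C$ infer $A\vdash C$; from $A\vdash B$ and $A\vdash C$ infer $A\vdash B\wedge C$; from $A\vdash B$ and $C\vdash B$ infer $A\vee C\vdash B$; from $A\vdash B$ infer $\neg B\vdash\neg A$. The extensions are obtained by adding one axiom scheme: $\mathsf{LQM}$: $A\vdash\neg\neg A$; $\mathsf{UQM}$: $\neg\neg A\vdash A$;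 $\mathsf{DP}$: $\neg A\wedge\neg\neg A\vdash\bot$; $\mathsf{AP}$: $A\wedge\neg A\vdash\bot$; $\mathsf{WS}$: $\top\vdash\neg A\vee\neg\neg A$. A semi De Morgan algebra (SMA) is an algebra $(L,\wedge,\vee,{}',\top,\bot)$ such that $(L,\wedge,\vee,\top,\bot)$ is a bounded distributive lattice and for all $a,b$: $\bot'=\top$, $\top'=\bot$, $(a\vee b)'=a'\wedge b'$, $(a\wedge b)''=a''\wedge b''$, $a'=a'''$. An LQMA is an SMA with $a\le a''$ for all $a$; a UQMA is an SMA with $a''\le a$; a DPL is an SMA with $a'\wedge a''=\bot$; an APL is an SMA with $a\wedge a'=\bot$; a WSA is an SMA with $a'\vee a''=\top$. Formulas are interpreted under valuations of the variables into $L$, with $\neg$ interpreted as ${}'$ and the other connectives as the lattice operations and bounds. *)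

theory Defs
  imports "HOL-Algebra.Lattice"
begin

section \<open>Formulas, sequents and logics\<close>

datatype form =
    Var nat
  | Top (\<open>\<^bold>\<top>\<close>)
  | Bot (\<open>\<^bold>\<bottom>\<close>)
  | Neg form (\<open>\<^bold>\<not>_\<close> [90] 90)
  | And form form (infixr \<open>\<^bold>\<and>\<close> 75)
  | Or form form (infixr \<open>\<^bold>\<or>\<close> 70)

datatype sequent = Sequent form form (infix \<open>\<turnstile>\<close> 55)

text \<open>The set of sequents derivable in semi De Morgan logic extended by the sequents in
  \<open>Ax\<close> as additional axioms.\<close>

inductive_set derivable :: "sequent set \<Rightarrow> sequent set" for Ax :: "sequent set" where
  extra: "s \<in> Ax \<Longrightarrow> s \<in> derivable Ax"
| bot: "\<^bold>\<bottom> \<turnstile> A \<in> derivable Ax"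
| top: "A \<turnstile> \<^bold>\<top> \<in> derivable Ax"
| neg_top: "\<^bold>\<not>\<^bold>\<top> \<turnstile> \<^bold>\<bottom> \<in> derivable Ax"
| neg_bot: "\<^bold>\<top> \<turnstile> \<^bold>\<not>\<^bold>\<bottom> \<in> derivable Ax"
| refl: "A \<turnstile> A \<in> derivable Ax"
| and1: "A \<^bold>\<and> B \<turnstile> A \<in> derivable Ax"
| and2: "A \<^bold>\<and> B \<turnstile> B \<in> derivable Ax"
| or1: "A \<turnstile> A \<^bold>\<or> B \<in> derivable Ax"
| or2: "B \<turnstile> A \<^bold>\<or> B \<in> derivable Ax"
| neg3I: "\<^bold>\<not>A \<turnstile> \<^bold>\<not>\<^bold>\<not>\<^bold>\<not>A \<in> derivable Ax"
| neg3E: "\<^bold>\<not>\<^bold>\<not>\<^bold>\<not>A \<turnstile> \<^bold>\<not>A \<in> derivable Ax"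
| neg_or: "\<^bold>\<not>A \<^bold>\<and> \<^bold>\<not>B \<turnstile> \<^bold>\<not>(A \<^bold>\<or> B) \<in> derivable Ax"
| neg2_and: "\<^bold>\<not>\<^bold>\<not>A \<^bold>\<and> \<^bold>\<not>\<^bold>\<not>B \<turnstile> \<^bold>\<not>\<^bold>\<not>(A \<^bold>\<and> B) \<in> derivable Ax"
| distrib: "A \<^bold>\<and> (B \<^bold>\<or> C) \<turnstile> (A \<^bold>\<and> B) \<^bold>\<or> (A \<^bold>\<and> C) \<in> derivable Ax"
| cut: "A \<turnstile> B \<in> derivable Ax \<Longrightarrow> B \<turnstile> C \<in> derivable Ax \<Longrightarrow> A \<turnstile> C \<in> derivable Ax"
| andR: "A \<turnstile> B \<in> derivable Ax \<Longrightarrow> A \<turnstile> C \<in> derivable Ax \<Longrightarrow> A \<turnstile> B \<^bold>\<and> C \<in> derivable Ax"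
| orL: "A \<turnstile> B \<in> derivable Ax \<Longrightarrow> C \<turnstile> B \<in> derivable Ax \<Longrightarrow> A \<^bold>\<or> C \<turnstile> B \<in> derivable Ax"
| contra: "A \<turnstile> B \<in> derivable Ax \<Longrightarrow> \<^bold>\<not>B \<turnstile> \<^bold>\<not>A \<in> derivable Ax"

definition SM :: "sequent set" where
  "SM = derivable {}"

definition LQM :: "sequent set" where
  "LQM = derivable {A \<turnstile> \<^bold>\<not>\<^bold>\<not>A | A. True}"

definition UQM :: "sequent set" where
  "UQM = derivable {\<^bold>\<not>\<^bold>\<not>A \<turnstile> A | A. True}"

definition DP :: "sequent set" where
  "DP = derivable {\<^bold>\<not>A \<^bold>\<and> \<^bold>\<not>\<^bold>\<not>A \<turnstile> \<^bold>\<bottom> | A. True}"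

definition AP :: "sequent set" where
  "AP = derivable {A \<^bold>\<and> \<^bold>\<not>A \<turnstile> \<^bold>\<bottom> | A. True}"

definition WS :: "sequent set" where
  "WS = derivable {\<^bold>\<top> \<turnstile> \<^bold>\<not>A \<^bold>\<or> \<^bold>\<not>\<^bold>\<not>A | A. True}"


section \<open>Semi De Morgan algebras\<close>

text \<open>The lattice operations and bounds are those that HOL-Algebra derives from the order of
  the structure; the locale \<^locale>\<open>bounded_lattice\<close> also forces the equality
  component of the structure to be plain equality.\<close>

record 'a neg_order = "'a gorder" +
  compl :: "'a \<Rightarrow> 'a" (\<open>_\<acute>\<index>\<close> [1000] 1000)

locale SMA = bounded_lattice L for L (structure) +
  assumes compl_closed: "a \<in> carrier L \<Longrightarrow> a\<acute> \<in> carrier L"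
    and meet_join_distrib:
      "\<lbrakk>a \<in> carrier L; b \<in> carrier L; c \<in> carrier L\<rbrakk> \<Longrightarrow>
        a \<sqinter> (b \<squnion> c) = (a \<sqinter> b) \<squnion> (a \<sqinter> c)"
    and compl_bottom: "\<bottom>\<acute> = \<top>"
    and compl_top: "\<top>\<acute> = \<bottom>"
    and compl_join: "\<lbrakk>a \<in> carrier L; b \<in> carrier L\<rbrakk> \<Longrightarrow> (a \<squnion> b)\<acute> = a\<acute> \<sqinter> b\<acute>"
    and compl2_meet: "\<lbrakk>a \<in> carrier L; b \<in> carrier L\<rbrakk> \<Longrightarrow> (a \<sqinter> b)\<acute>\<acute> = a\<acute>\<acute> \<sqinter> b\<acute>\<acute>"
    and compl3: "a \<in> carrier L \<Longrightarrow> a\<acute> = a\<acute>\<acute>\<acute>"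

locale LQMA = SMA +
  assumes le_compl2: "a \<in> carrier L \<Longrightarrow> a \<sqsubseteq> a\<acute>\<acute>"

locale UQMA = SMA +
  assumes compl2_le: "a \<in> carrier L \<Longrightarrow> a\<acute>\<acute> \<sqsubseteq> a"

locale DPL = SMA +
  assumes compl_meet_compl2: "a \<in> carrier L \<Longrightarrow> a\<acute> \<sqinter> a\<acute>\<acute> = \<bottom>"

locale APL = SMA +
  assumes meet_compl: "a \<in> carrier L \<Longrightarrow> a \<sqinter> a\<acute> = \<bottom>"

locale WSA = SMA +
  assumes compl_join_compl2: "a \<in> carrier L \<Longrightarrow> a\<acute> \<squnion> a\<acute>\<acute> = \<top>"


section \<open>Interpretation of formulas\<close>

primrec interp :: "('a, 'b) neg_order_scheme \<Rightarrow> (nat \<Rightarrow> 'a) \<Rightarrow> form \<Rightarrow> 'a" where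
  "interp L v (Var p) = v p"
| "interp L v \<^bold>\<top> = \<top>\<^bsub>L\<^esub>"
| "interp L v \<^bold>\<bottom> = \<bottom>\<^bsub>L\<^esub>"
| "interp L v (\<^bold>\<not>A) = (interp L v A)\<acute>\<^bsub>L\<^esub>"
| "interp L v (A \<^bold>\<and> B) = interp L v A \<sqinter>\<^bsub>L\<^esub> interp L v B"
| "interp L v (A \<^bold>\<or> B) = interp L v A \<squnion>\<^bsub>L\<^esub> interp L v B"

text \<open>\<open>valid_in K A B\<close>: the inequality \<open>A \<le> B\<close> holds under every valuation in every
  algebra that belongs to the class \<open>K\<close> and whose carrier is a subset (of any cardinality)
  of the type \<^typ>\<open>'a\<close>. For infinite \<^typ>\<open>'a\<close> this covers, up to isomorphism, all countable
  algebras.\<close>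

definition valid_in :: "('a neg_order \<Rightarrow> bool) \<Rightarrow> form \<Rightarrow> form \<Rightarrow> bool" where
  "valid_in K A B \<longleftrightarrow>
    (\<forall>L v. K L \<longrightarrow> v \<in> UNIV \<rightarrow> carrier L \<longrightarrow> interp L v A \<sqsubseteq>\<^bsub>L\<^esub> interp L v B)"

end

theory Submission
  imports Defs "HOL-Library.Countable"
begin

text \<open>The Lindenbaum algebra of each logic, i.e. the formulas modulo interderivability ordered
  by derivability, belongs to the corresponding class, and under the canonical valuation every
  formula denotes its own class. As there are only countably many formulas, the classes can be
  named by elements of any infinite type.\<close>

instance form :: countable
  by countable_datatype

lemma neg_or_converse:
  "\<^bold>\<not>(A \<^bold>\<or> B) \<turnstile> \<^bold>\<not>A \<^bold>\<and> \<^bold>\<not>B \<in> derivable Ax"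
  by (intro derivable.andR derivable.contra derivable.or1 derivable.or2)

lemma neg2_and_converse:
  "\<^bold>\<not>\<^bold>\<not>(A \<^bold>\<and> B) \<turnstile> \<^bold>\<not>\<^bold>\<not>A \<^bold>\<and> \<^bold>\<not>\<^bold>\<not>B \<in> derivable Ax"
  by (intro derivable.andR derivable.contra derivable.and1 derivable.and2)

lemma distrib_converse:
  "(A \<^bold>\<and> B) \<^bold>\<or> (A \<^bold>\<and> C) \<turnstile> A \<^bold>\<and> (B \<^bold>\<or> C) \<in> derivable Ax"
  by (meson derivable.intros)

text \<open>\<open>q A\<close> is an arbitrary name of the class of \<open>A\<close>, so that no quotient type is needed.\<close>

locale lindenbaum =
  fixes Ax :: "sequent set" and q :: "form \<Rightarrow> 'a"
  assumes q_eq_iff: "q A = q B \<longleftrightarrow> A \<turnstile> B \<in> derivable Ax \<and> B \<turnstile> A \<in> derivable Ax"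
begin

text \<open>Only the order and the negation are given; meets, joins and bounds come from the order.
  Negation acts on a representative picked by \<open>inv q\<close>, and the order asks for some pair
  of representatives, so independence of these choices remains to be shown.\<close>

definition alg :: "'a neg_order" where
  "alg = \<lparr>carrier = range q, eq = (=),
    le = (\<lambda>x y. \<exists>A B. x = q A \<and> y = q B \<and> A \<turnstile> B \<in> derivable Ax),
    compl = (\<lambda>x. q (\<^bold>\<not>(inv q x)))\<rparr>"

lemma alg_simps [simp]: "carrier alg = range q" "eq alg = (=)"
  by (simp_all add: alg_def)

lemma q_in_carrier: "q A \<in> carrier alg"
  by simp

lemma le_alg_iff [simp]: "q A \<sqsubseteq>\<^bsub>alg\<^esub> q B \<longleftrightarrow> A \<turnstile> B \<in> derivable Ax"
  by (auto simp: alg_def q_eq_iff intro: derivable.refl) (meson derivable.cut)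

lemma compl_alg [simp]: "(q A)\<acute>\<^bsub>alg\<^esub> = q (\<^bold>\<not>A)"
proof -
  \<comment> \<open>\<open>inv q (q A)\<close> need not be \<open>A\<close> itself, but it is
    interderivable with \<open>A\<close>, and \<open>contra\<close> carries this over to the
    negations.\<close>
  have "q (inv q (q A)) = q A"
    by (simp add: f_inv_into_f)
  then show ?thesis
    by (simp add: alg_def q_eq_iff derivable.contra)
qed

text \<open>\<open>or1\<close> and \<open>or2\<close> make the disjunction an upper bound, and
  \<open>orL\<close> makes it the least one.\<close>

lemma least_upper_alg: "least alg (q (A \<^bold>\<or> B)) (Upper alg {q A, q B})"
  by (rule least_UpperI)
    (auto simp: Upper_def all_conj_distrib intro: derivable.or1 derivable.or2 derivable.orL)

lemma greatest_lower_alg: "greatest alg (q (A \<^bold>\<and> B)) (Lower alg {q A, q B})"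
  by (rule greatest_LowerI)
    (auto simp: Lower_def all_conj_distrib intro: derivable.and1 derivable.and2 derivable.andR)

lemma least_alg: "least alg (q \<^bold>\<bottom>) (carrier alg)"
  by (auto simp: least_def intro: derivable.bot)

lemma greatest_alg: "greatest alg (q \<^bold>\<top>) (carrier alg)"
  by (auto simp: greatest_def intro: derivable.top)

sublocale bounded_lattice alg
proof
  show "\<exists>x. least alg x (carrier alg)" "\<exists>x. greatest alg x (carrier alg)"
    using least_alg greatest_alg by blast+
qed (auto simp: q_eq_iff intro: derivable.refl derivable.cut least_upper_alg greatest_lower_alg)

text \<open>The join is a chosen least upper bound. Such bounds are unique up to
  \<open>eq alg\<close>, which is plain equality.\<close>

lemma join_alg [simp]: "q A \<squnion>\<^bsub>alg\<^esub> q B = q (A \<^bold>\<or> B)"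
  by (rule joinI[OF _ q_in_carrier q_in_carrier])
    (metis least_upper_alg weak_least_unique alg_simps(2))

lemma meet_alg [simp]: "q A \<sqinter>\<^bsub>alg\<^esub> q B = q (A \<^bold>\<and> B)"
  by (rule meetI[OF _ q_in_carrier q_in_carrier])
    (metis greatest_lower_alg weak_greatest_unique alg_simps(2))

lemma bottom_alg [simp]: "\<bottom>\<^bsub>alg\<^esub> = q \<^bold>\<bottom>"
  using weak_least_unique[OF bottom_least least_alg] by simp

lemma top_alg [simp]: "\<top>\<^bsub>alg\<^esub> = q \<^bold>\<top>"
  using weak_greatest_unique[OF top_greatest greatest_alg] by simp

text \<open>Each law is an equality of names, hence by \<open>q_eq_iff\<close> a pair of
  derivations. One is an axiom; the other is an axiom too or one of the converses proved
  above.\<close>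

sublocale SMA alg
proof
  fix a b c
  assume "a \<in> carrier alg" "b \<in> carrier alg" "c \<in> carrier alg"
  then obtain A B C where "a = q A" "b = q B" "c = q C"
    by auto
  then show "a \<sqinter>\<^bsub>alg\<^esub> (b \<squnion>\<^bsub>alg\<^esub> c) = (a \<sqinter>\<^bsub>alg\<^esub> b) \<squnion>\<^bsub>alg\<^esub> (a \<sqinter>\<^bsub>alg\<^esub> c)"
    by (simp add: q_eq_iff derivable.distrib distrib_converse)
qed (use neg_or_converse neg2_and_converse in \<open>force simp: q_eq_iff
      intro: derivable.bot derivable.top derivable.neg_top derivable.neg_bot derivable.neg_or
        derivable.neg2_and derivable.neg3I derivable.neg3E\<close>)+

lemma SMA_alg: "SMA alg"
  by unfold_locales

lemma LQMA_alg:
  assumes "\<And>A. A \<turnstile> \<^bold>\<not>\<^bold>\<not>A \<in> derivable Ax"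
  shows "LQMA alg"
  by unfold_locales (use assms in auto)

lemma UQMA_alg:
  assumes "\<And>A. \<^bold>\<not>\<^bold>\<not>A \<turnstile> A \<in> derivable Ax"
  shows "UQMA alg"
  by unfold_locales (use assms in auto)

lemma DPL_alg:
  assumes "\<And>A. \<^bold>\<not>A \<^bold>\<and> \<^bold>\<not>\<^bold>\<not>A \<turnstile> \<^bold>\<bottom> \<in> derivable Ax"
  shows "DPL alg"
  by unfold_locales (use assms in \<open>auto simp: q_eq_iff intro: derivable.bot\<close>)

lemma APL_alg:
  assumes "\<And>A. A \<^bold>\<and> \<^bold>\<not>A \<turnstile> \<^bold>\<bottom> \<in> derivable Ax"
  shows "APL alg"
  by unfold_locales (use assms in \<open>auto simp: q_eq_iff intro: derivable.bot\<close>)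

lemma WSA_alg:
  assumes "\<And>A. \<^bold>\<top> \<turnstile> \<^bold>\<not>A \<^bold>\<or> \<^bold>\<not>\<^bold>\<not>A \<in> derivable Ax"
  shows "WSA alg"
  by unfold_locales (use assms in \<open>auto simp: q_eq_iff intro: derivable.top\<close>)

lemma interp_alg: "interp alg (\<lambda>p. q (Var p)) A = q A"
  by (induction A) simp_all

text \<open>The class \<open>K\<close> is kept abstract so that one evaluation at the canonical
  valuation serves all six logics.\<close>

lemma derivable_if_valid_in:
  assumes "valid_in K A B" "K alg"
  shows "A \<turnstile> B \<in> derivable Ax"
proof -
  have "interp alg (\<lambda>p. q (Var p)) A \<sqsubseteq>\<^bsub>alg\<^esub> interp alg (\<lambda>p. q (Var p)) B"
    using assms by (auto simp: valid_in_def)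
  then show ?thesis
    by (simp add: interp_alg)
qed

end

text \<open>A formula is named by choosing a representative of its class, coding it as a natural
  number and injecting that into the given type.\<close>

lemma ex_lindenbaum:
  assumes "infinite (UNIV :: 'a set)"
  shows "\<exists>q :: form \<Rightarrow> 'a. lindenbaum Ax q"
proof -
  obtain g :: "nat \<Rightarrow> 'a" where "inj g"
    using infinite_countable_subset[OF assms] by blast
  then have inj: "inj (g \<circ> to_nat :: form \<Rightarrow> 'a)"
    by (simp add: inj_compose)
  define R where "R A B \<longleftrightarrow> A \<turnstile> B \<in> derivable Ax \<and> B \<turnstile> A \<in> derivable Ax" for A B
  have "equivp R"
    by (rule equivpI) (auto simp: R_def reflp_def symp_def transp_def intro: derivable.refl derivable.cut)
  \<comment> \<open>Equivalent formulas have the same predicate \<open>R A\<close>, hence the same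
    choice. Conversely, a common choice lies in both classes, which therefore coincide.\<close>
  then have "Eps (R A) = Eps (R B) \<longleftrightarrow> R A B" for A B
    by (metis equivp_def someI)
  then have "lindenbaum Ax (\<lambda>A. (g \<circ> to_nat) (Eps (R A)))"
    using inj_eq[OF inj] R_def by (simp add: lindenbaum_def)
  then show ?thesis
    by blast
qed

lemma derivable_if_valid_in_class:
  assumes "infinite (UNIV :: 'a set)" "valid_in (K :: 'a neg_order \<Rightarrow> bool) A B"
    and "\<And>q :: form \<Rightarrow> 'a. lindenbaum Ax q \<Longrightarrow> K (lindenbaum.alg Ax q)"
  shows "A \<turnstile> B \<in> derivable Ax"
  using ex_lindenbaum[OF assms(1)] assms(2,3) lindenbaum.derivable_if_valid_in by blast

theorem theorem2p5:
  assumes "infinite (UNIV :: 'a set)"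
  shows "(\<forall>A B. valid_in (SMA :: 'a neg_order \<Rightarrow> bool) A B \<longrightarrow> A \<turnstile> B \<in> SM)
    \<and> (\<forall>A B. valid_in (LQMA :: 'a neg_order \<Rightarrow> bool) A B \<longrightarrow> A \<turnstile> B \<in> LQM)
    \<and> (\<forall>A B. valid_in (UQMA :: 'a neg_order \<Rightarrow> bool) A B \<longrightarrow> A \<turnstile> B \<in> UQM)
    \<and> (\<forall>A B. valid_in (DPL :: 'a neg_order \<Rightarrow> bool) A B \<longrightarrow> A \<turnstile> B \<in> DP)
    \<and> (\<forall>A B. valid_in (APL :: 'a neg_order \<Rightarrow> bool) A B \<longrightarrow> A \<turnstile> B \<in> AP)
    \<and> (\<forall>A B. valid_in (WSA :: 'a neg_order \<Rightarrow> bool) A B \<longrightarrow> A \<turnstile> B \<in> WS)"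
proof -
  note derivableI = derivable_if_valid_in_class[OF assms]
  show ?thesis
    unfolding SM_def LQM_def UQM_def DP_def AP_def WS_def
    \<comment> \<open>What is left is that the Lindenbaum algebra lies in the class;
      \<open>extra\<close> supplies the characteristic scheme of each proper extension.\<close>
    by (intro conjI allI impI; erule derivableI;
        blast intro: lindenbaum.SMA_alg lindenbaum.LQMA_alg lindenbaum.UQMA_alg
          lindenbaum.DPL_alg lindenbaum.APL_alg lindenbaum.WSA_alg derivable.extra)
qed

end
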